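(* For every $a>1$, as $L\to\infty$, $$\operatorname{Var}(N_{[1,a]}(L))=L\,\frac{(a-1)(a+3)}{8\pi a(a+1)}+\frac1{\pi^2}\log\frac{(a+1)^2}{4a}+o(1).$$ More generally, for $I=[\alpha,\beta]$ with $0<\alpha<\beta<\infty$ and $a=\beta/\alpha$, as $L\to\infty$, $$\operatorname{Var}(N_I(L))=L\,\alpha^{-1}\frac{(a-1)(a+3)}{8\pi a(a+1)}+\frac1{\pi^2}\log\frac{(a+1)^2}{4a}+o(1).$$
   Context: Let $\mathbb H=\{z\in\mathbb C:\operatorname{Im}z>0\}$ with planar Lebesgue measure $\mathrm dA$, and let $\mathcal Z$ be the determinantal point process on $(\mathbb H,\mathrm dA)$ with Hermitian correlation kernel $K_{\mathbb H}(z,w)=-\frac{1}{\pi(z-\overline w)^2}$. For a compact interval $I\subset(0,\infty)$ and $L>0$ set $N_I(L):=\#\{z\in\mathcal Z:0\le\operatorname{Re}z\le L,\ \operatorname{Im}z\in I\}$. *)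

theory Defs
  imports "HOL-Probability.Probability" "HOL-Library.Landau_Symbols"
    "Jordan_Normal_Form.Determinant"
begin

text \<open>
  A simple point process on an open subset \<open>D\<close> of the plane: a random locally finite subset of \<open>D\<close>,
  measurable in the sense that its number of points in every relatively compact Borel subset of
  \<open>D\<close> is a random variable.
\<close>

locale point_process = prob_space M
  for M :: "'w measure" and D :: "complex set" and Z :: "'w \<Rightarrow> complex set" +
  assumes open_domain: "open D"
    and points_in_domain: "\<omega> \<in> space M \<Longrightarrow> Z \<omega> \<subseteq> D"
    and locally_finite: "\<omega> \<in> space M \<Longrightarrow> compact C \<Longrightarrow> C \<subseteq> D \<Longrightarrow> finite (Z \<omega> \<inter> C)"
    and measurable_count: "compact C \<Longrightarrow> C \<subseteq> D \<Longrightarrow> B \<in> sets borel \<Longrightarrow> B \<subseteq> C \<Longrightarrow>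
      (\<lambda>\<omega>. card (Z \<omega> \<inter> B)) \<in> measurable M (count_space UNIV)"

definition distinct_tuples :: "nat \<Rightarrow> 'a set \<Rightarrow> (nat \<Rightarrow> 'a) set" where
  "distinct_tuples k S = {x \<in> {..<k} \<rightarrow>\<^sub>E S. inj_on x {..<k}}"

definition area_power :: "nat \<Rightarrow> complex set \<Rightarrow> (nat \<Rightarrow> complex) measure" where
  "area_power k D = (\<Pi>\<^sub>M i\<in>{..<k}. restrict_space lborel D)"

text \<open>
  \<open>\<rho>\<close> is the \<open>k\<close>-point correlation function (joint intensity) with respect to planar Lebesgue
  measure: the expected sum of \<open>f\<close> over the ordered \<open>k\<close>-tuples of distinct points of the process
  is the integral of \<open>f \<rho>\<close> over the \<open>k\<close>-th power of \<open>D\<close>.  The sum over tuples is written as an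
  integral against counting measure, with values in \<open>[0,\<infinity>]\<close>.
\<close>

definition (in point_process) correlation_function ::
    "nat \<Rightarrow> ((nat \<Rightarrow> complex) \<Rightarrow> real) \<Rightarrow> bool" where
  "correlation_function k \<rho> \<longleftrightarrow>
     \<rho> \<in> borel_measurable (area_power k D) \<and>
     (\<forall>x \<in> {..<k} \<rightarrow>\<^sub>E D. 0 \<le> \<rho> x) \<and>
     (\<forall>f \<in> borel_measurable (area_power k D).
        (\<integral>\<^sup>+\<omega>. (\<integral>\<^sup>+x. f x \<partial>count_space (distinct_tuples k (Z \<omega>))) \<partial>M) =
        (\<integral>\<^sup>+x. f x * ennreal (\<rho> x) \<partial>area_power k D))"

text \<open>
  The kernel is Hermitian, so the determinant below is real; taking its real part only changes
  the type.
\<close>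

locale determinantal_process = point_process M D Z
  for M :: "'w measure" and D :: "complex set" and Z :: "'w \<Rightarrow> complex set" +
  fixes K :: "complex \<Rightarrow> complex \<Rightarrow> complex"
  assumes hermitian_kernel: "z \<in> D \<Longrightarrow> w \<in> D \<Longrightarrow> K w z = cnj (K z w)"
    and determinantal:
      "k \<ge> 1 \<Longrightarrow> correlation_function k
         (\<lambda>x. Re (Determinant.det (Matrix.mat k k (\<lambda>(i, j). K (x i) (x j)))))"

definition upper_half_plane :: "complex set" where
  "upper_half_plane = {z. Im z > 0}"

definition K_half_plane :: "complex \<Rightarrow> complex \<Rightarrow> complex" where
  "K_half_plane z w = - 1 / (of_real pi * (z - cnj w)\<^sup>2)"

definition point_count :: "('w \<Rightarrow> complex set) \<Rightarrow> real set \<Rightarrow> real \<Rightarrow> 'w \<Rightarrow> real" where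
  "point_count Z I L \<omega> = real (card {z \<in> Z \<omega>. 0 \<le> Re z \<and> Re z \<le> L \<and> Im z \<in> I})"

end

theory Submission
  imports Defs "HOL-Real_Asymp.Real_Asymp"
begin

text \<open>
  For a determinantal process the two-point correlation \<open>K(z,z) K(w,w) - |K(z,w)|\<^sup>2\<close> determines the
  second moment of a count, and the product \<open>K(z,z) K(w,w)\<close> cancels against the square of the
  mean: the number of points in a relatively compact set \<open>B\<close> has variance
  \<open>\<integral>\<^sub>B K(z,z) - \<integral>\<^sub>B\<integral>\<^sub>B |K(z,w)|\<^sup>2\<close> (\<open>variance_card\<close>).

  Let \<open>B = [0,L] \<times> [\<alpha>,\<beta>]\<close>.  The first term is linear in \<open>L\<close>.  For the second,
  \<open>|K(z,w)|\<^sup>2 = 1 / (\<pi>\<^sup>2 (t\<^sup>2 + s\<^sup>2)\<^sup>2)\<close> depends only on the difference \<open>t\<close> of the real parts and the sum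
  \<open>s\<close> of the imaginary parts.  The double integral of a function of \<open>x \<plusminus> y\<close> over a
  rectangle is a second difference of a second antiderivative, so both pairs of
  coordinates can be integrated by inspection (\<open>nn_integral_second_difference\<close>).  Since
  \<open>1 / (t\<^sup>2 + s\<^sup>2)\<^sup>2\<close> is the second derivative of \<open>t arctan(t/s) / (2 s\<^sup>3)\<close>, the real parts contribute,
  up to the factor \<open>1 / \<pi>\<^sup>2\<close>, exactly \<open>L arctan(L/s) / s\<^sup>3\<close>.  This is
  \<open>\<pi> L / (2 s\<^sup>3) - 1 / s\<^sup>2 + O(1 / L\<^sup>2)\<close>, and a second antiderivative in \<open>s\<close> of the explicit part is
  \<open>\<pi> L / (4 s) + ln s\<close>.
  Its second difference at \<open>2\<alpha>\<close>, \<open>\<alpha>+\<beta>\<close>, \<open>2\<beta>\<close> yields a term linear in \<open>L\<close>, which combines with the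
  mean, and the constant \<open>- ln ((\<alpha>+\<beta>)\<^sup>2 / (4\<alpha>\<beta>))\<close>, which the minus sign in the variance formula turns
  into the positive logarithmic term.  The argument gives the explicit error bound
  \<open>(\<beta>-\<alpha>)\<^sup>2 / (3 \<pi>\<^sup>2 L\<^sup>2)\<close> (\<open>half_plane_variance_estimate\<close>).
\<close>

section \<open>The variance of a count in a determinantal process\<close>

lemma det_mat_2:
  fixes f :: "nat \<times> nat \<Rightarrow> 'a :: comm_ring_1"
  shows "Determinant.det (Matrix.mat 2 2 f) = f (0, 0) * f (1, 1) - f (0, 1) * f (1, 0)"
proof -
  have "Determinant.det (Matrix.mat 2 2 f) =
     (\<Sum>j<2. Matrix.mat 2 2 f $$ (0, j) * cofactor (Matrix.mat 2 2 f) 0 j)"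
    by (rule laplace_expansion_row[of _ 2]) auto
  also have "\<dots> = f (0, 0) * f (1, 1) - f (0, 1) * f (1, 0)"
    by (simp add: numeral_2_eq_2 cofactor_def det_single mat_delete_def)
  finally show ?thesis .
qed

lemma card_distinct_tuples_1: "card (distinct_tuples 1 S) = card S"
proof -
  have "bij_betw (\<lambda>a. \<lambda>i\<in>{..<1::nat}. a) S (distinct_tuples 1 S)"
    by (rule bij_betwI[where g = "\<lambda>x. x 0"])
      (auto simp: distinct_tuples_def PiE_def extensional_def fun_eq_iff inj_on_def)
  then show ?thesis by (metis bij_betw_same_card)
qed

lemma card_distinct_tuples_2:
  assumes "finite S"
  shows "card (distinct_tuples 2 S) + card S = card S ^ 2"
proof -
  have two: "{..<2} = {0, 1 :: nat}" by auto
  have "bij_betw (\<lambda>x :: nat \<Rightarrow> _. (x 0, x 1)) (distinct_tuples 2 S) (S \<times> S - (\<lambda>a. (a, a)) ` S)"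
    unfolding bij_betw_def
  proof
    show "inj_on (\<lambda>x :: nat \<Rightarrow> _. (x 0, x 1)) (distinct_tuples 2 S)"
      by (rule inj_onI, rule PiE_ext[of _ "{..<2}" "\<lambda>_. S"]) (auto simp: distinct_tuples_def two)
    show "(\<lambda>x :: nat \<Rightarrow> _. (x 0, x 1)) ` distinct_tuples 2 S = S \<times> S - (\<lambda>a. (a, a)) ` S"
    proof (intro equalityI subsetI)
      fix p assume "p \<in> S \<times> S - (\<lambda>a. (a, a)) ` S"
      then obtain a b where p: "p = (a, b)" "a \<in> S" "b \<in> S" "a \<noteq> b" by auto
      then have "(\<lambda>i\<in>{..<2}. if i = 0 then a else b) \<in> distinct_tuples 2 S"
        by (simp add: distinct_tuples_def two)
      then show "p \<in> (\<lambda>x :: nat \<Rightarrow> _. (x 0, x 1)) ` distinct_tuples 2 S"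
        by (rule rev_image_eqI) (simp add: p(1))
    next
      fix p assume "p \<in> (\<lambda>x :: nat \<Rightarrow> _. (x 0, x 1)) ` distinct_tuples 2 S"
      then obtain x where x: "x \<in> {..<2::nat} \<rightarrow>\<^sub>E S" "inj_on x {..<2}" and p: "p = (x 0, x 1)"
        unfolding distinct_tuples_def by blast
      have "x 0 \<in> S" "x 1 \<in> S" "x 0 \<noteq> x 1"
        using PiE_mem[OF x(1), of 0] PiE_mem[OF x(1), of 1] inj_onD[OF x(2), of 0 1] by auto
      then show "p \<in> S \<times> S - (\<lambda>a. (a, a)) ` S"
        unfolding p by auto
    qed
  qed
  then have "card (distinct_tuples 2 S) = card (S \<times> S - (\<lambda>a. (a, a)) ` S)"
    by (rule bij_betw_same_card)
  also have "\<dots> = card (S \<times> S) - card ((\<lambda>a. (a, a)) ` S)"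
    using assms by (intro card_Diff_subset) auto
  also have "card ((\<lambda>a. (a, a)) ` S) = card S"
    by (rule card_image) (simp add: inj_on_def)
  finally show ?thesis
    by (simp add: card_cartesian_product power2_eq_square)
qed

text \<open>
  The number of \<open>k\<close>-tuples of distinct points in \<open>B\<close> is the \<open>k\<close>-th falling factorial of the count,
  so this expresses factorial moments through correlation functions: it is the defining identity
  of \<open>\<rho>\<close> tested against the indicator function of \<open>B\<^sup>k\<close>.
\<close>

lemma (in point_process) nn_integral_card_distinct_tuples:
  assumes \<rho>: "correlation_function k \<rho>"
    and C: "compact C" "C \<subseteq> D" "B \<in> sets borel" "B \<subseteq> C"
  shows "(\<integral>\<^sup>+\<omega>. of_nat (card (distinct_tuples k (Z \<omega> \<inter> B))) \<partial>M)
    = (\<integral>\<^sup>+x\<in>{..<k} \<rightarrow>\<^sub>E B. ennreal (\<rho> x) \<partial>area_power k D)"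
proof -
  have "B \<in> sets (restrict_space lborel D)"
    using C by (auto simp: sets_restrict_space image_iff intro!: bexI[of _ B])
  then have "({..<k} \<rightarrow>\<^sub>E B) \<in> sets (area_power k D)"
    unfolding area_power_def by (intro sets_PiM_I_finite) auto
  then have "(\<integral>\<^sup>+\<omega>. (\<integral>\<^sup>+x. indicator ({..<k} \<rightarrow>\<^sub>E B) x \<partial>count_space (distinct_tuples k (Z \<omega>))) \<partial>M)
      = (\<integral>\<^sup>+x. indicator ({..<k} \<rightarrow>\<^sub>E B) x * ennreal (\<rho> x) \<partial>area_power k D)"
    using \<rho> unfolding correlation_function_def by (blast intro: borel_measurable_indicator)
  moreover have "(\<integral>\<^sup>+x. indicator ({..<k} \<rightarrow>\<^sub>E B) x \<partial>count_space (distinct_tuples k (Z \<omega>)))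
      = of_nat (card (distinct_tuples k (Z \<omega> \<inter> B)))" if "\<omega> \<in> space M" for \<omega>
  proof -
    have eq: "distinct_tuples k (Z \<omega> \<inter> B) = ({..<k} \<rightarrow>\<^sub>E B) \<inter> distinct_tuples k (Z \<omega>)"
      by (auto simp: distinct_tuples_def PiE_def)
    have "finite (Z \<omega> \<inter> B)"
      using locally_finite[OF that C(1,2)] C(4) by (meson Int_mono finite_subset order_refl)
    then have "finite (distinct_tuples k (Z \<omega> \<inter> B))"
      unfolding distinct_tuples_def by (simp add: finite_PiE)
    moreover have "(\<integral>\<^sup>+x. indicator ({..<k} \<rightarrow>\<^sub>E B) x \<partial>count_space (distinct_tuples k (Z \<omega>)))
      = (\<integral>\<^sup>+x. indicator (distinct_tuples k (Z \<omega> \<inter> B)) x \<partial>count_space (distinct_tuples k (Z \<omega>)))"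
      by (intro nn_integral_cong) (auto simp: eq split: split_indicator)
    moreover have "\<dots> = emeasure (count_space (distinct_tuples k (Z \<omega>))) (distinct_tuples k (Z \<omega> \<inter> B))"
      by (rule nn_integral_indicator) (auto simp: eq)
    ultimately show ?thesis
      by (simp add: emeasure_count_space_finite eq)
  qed
  ultimately show ?thesis
    by (simp add: mult.commute cong: nn_integral_cong)
qed

context determinantal_process
begin

lemma correlation_function_1: "correlation_function 1 (\<lambda>x. Re (K (x 0) (x 0)))"
  using determinantal[of 1] by (simp add: det_single)

lemma kernel_diagonal:
  assumes "z \<in> D"
  shows "K z z = of_real (Re (K z z))" "0 \<le> Re (K z z)"
proof -
  show "K z z = of_real (Re (K z z))"
    using hermitian_kernel[OF assms assms] by (simp add: complex_eq_iff)
  show "0 \<le> Re (K z z)"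
    using correlation_function_1 assms unfolding correlation_function_def
    by (auto dest!: bspec[of _ _ "\<lambda>i\<in>{..<1::nat}. z"])
qed

lemma determinant_2:
  assumes "z \<in> D" "w \<in> D"
  shows "Re (K z z * K w w - K z w * K w z) = Re (K z z) * Re (K w w) - (cmod (K z w))\<^sup>2"
proof -
  have "K z z * K w w - K z w * K w z = of_real (Re (K z z) * Re (K w w) - (cmod (K z w))\<^sup>2)"
    using kernel_diagonal(1)[OF assms(1)] kernel_diagonal(1)[OF assms(2)]
      hermitian_kernel[OF assms]
    by (simp add: complex_norm_square flip: of_real_power)
  then show ?thesis by simp
qed

lemma correlation_function_2:
  "correlation_function 2
    (\<lambda>x. Re (K (x 0) (x 0) * K (x 1) (x 1) - K (x 0) (x 1) * K (x 1) (x 0)))"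
  using determinantal[of 2] by (simp add: det_mat_2)

text \<open>
  With \<open>N\<close> the count, \<open>N\<^sup>2 = N (N - 1) + N\<close>; the factorial moments are \<open>E N = m\<close> and
  \<open>E N (N - 1) = m\<^sup>2 - v\<close>, whence \<open>Var N = (m\<^sup>2 - v) + m - m\<^sup>2\<close>.  The square
  integrability of \<open>N\<close> comes with it: both moments are computed as integrals in \<open>[0,\<infinity>]\<close>
  and turn out finite.
\<close>

lemma variance_card:
  assumes C: "compact C" "C \<subseteq> D" and B[measurable]: "B \<in> sets borel" and "B \<subseteq> C"
    and K[measurable]: "(\<lambda>(z, w). K z w) \<in> borel_measurable (restrict_space lborel D \<Otimes>\<^sub>M restrict_space lborel D)"
    and m: "(\<integral>\<^sup>+z\<in>B. ennreal (Re (K z z)) \<partial>lborel) = ennreal m" "0 \<le> m"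
    and v: "(\<integral>\<^sup>+z\<in>B. (\<integral>\<^sup>+w\<in>B. ennreal ((cmod (K z w))\<^sup>2) \<partial>lborel) \<partial>lborel) = ennreal v" "0 \<le> v"
  shows "variance (\<lambda>\<omega>. real (card (Z \<omega> \<inter> B))) = m - v"
proof -
  define R where "R = restrict_space (lborel :: complex measure) D"
  have D: "D \<in> sets borel" using open_domain by simp
  have "B \<subseteq> D" using assms by auto
  interpret R: sigma_finite_measure R
    unfolding R_def using lborel.sigma_finite_measure_axioms open_domain
    by (intro sigma_finite_measure_restrict_space) auto
  interpret RR: product_sigma_finite "\<lambda>_ :: nat. R" by unfold_locales
  have BR[measurable]: "B \<in> sets R"
    using \<open>B \<subseteq> D\<close> B by (auto simp: R_def sets_restrict_space image_iff intro!: bexI[of _ B])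
  have K2[measurable]: "(\<lambda>p. K (fst p) (snd p)) \<in> borel_measurable (R \<Otimes>\<^sub>M R)"
    using K by (simp add: R_def split_beta)
  have K1[measurable]: "(\<lambda>z. K z z) \<in> borel_measurable R"
    using measurable_compose[of "\<lambda>z. (z, z)" R "R \<Otimes>\<^sub>M R", OF _ K2] by simp
  have R_int: "(\<integral>\<^sup>+z\<in>B. f z \<partial>R) = (\<integral>\<^sup>+z\<in>B. f z \<partial>lborel)" for f
    unfolding R_def using D \<open>B \<subseteq> D\<close>
    by (subst nn_integral_restrict_space) (auto intro!: nn_integral_cong split: split_indicator)
  have spR: "space R = D" by (simp add: R_def space_restrict_space)

  define N where "N \<omega> = card (Z \<omega> \<inter> B)" for \<omega>
  have fin: "finite (Z \<omega> \<inter> B)" if "\<omega> \<in> space M" for \<omega>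
    using locally_finite[OF that C(1,2)] \<open>B \<subseteq> C\<close> by (meson Int_mono finite_subset order_refl)
  have N[measurable]: "N \<in> measurable M (count_space UNIV)"
    unfolding N_def using measurable_count[OF C B \<open>B \<subseteq> C\<close>] .

  have EN: "(\<integral>\<^sup>+\<omega>. ennreal (real (N \<omega>)) \<partial>M) = ennreal m"
  proof -
    have "(\<integral>\<^sup>+\<omega>. ennreal (real (N \<omega>)) \<partial>M)
        = (\<integral>\<^sup>+x\<in>{..<1::nat} \<rightarrow>\<^sub>E B. ennreal (Re (K (x 0) (x 0))) \<partial>area_power 1 D)"
      using nn_integral_card_distinct_tuples[OF correlation_function_1 C B \<open>B \<subseteq> C\<close>]
      unfolding card_distinct_tuples_1 N_def by (simp add: ennreal_of_nat_eq_real_of_nat)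
    also have "\<dots> = (\<integral>\<^sup>+x. (\<lambda>z. ennreal (Re (K z z)) * indicator B z) (x 0) \<partial>Pi\<^sub>M {0} (\<lambda>_::nat. R))"
      unfolding area_power_def R_def[symmetric]
      by (auto simp: lessThan_Suc space_PiM PiE_def intro!: nn_integral_cong split: split_indicator)
    also have "\<dots> = (\<integral>\<^sup>+z\<in>B. ennreal (Re (K z z)) \<partial>R)"
      by (subst RR.product_nn_integral_singleton) auto
    finally show ?thesis by (simp add: R_int m)
  qed

  \<comment> \<open>The identity is stated additively because subtraction in \<open>[0,\<infinity>]\<close> is truncated.\<close>
  have E2: "(\<integral>\<^sup>+\<omega>. ennreal (real (N \<omega>) ^ 2 - real (N \<omega>)) \<partial>M) + ennreal v = ennreal (m\<^sup>2)"
  proof -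
    let ?\<rho> = "\<lambda>z w. Re (K z z * K w w - K z w * K w z)"
    have K2'[measurable]: "(\<lambda>p. K (snd p) (fst p)) \<in> borel_measurable (R \<Otimes>\<^sub>M R)"
      using measurable_compose[of "\<lambda>p. (snd p, fst p)" "R \<Otimes>\<^sub>M R" "R \<Otimes>\<^sub>M R", OF _ K2] by simp
    have "(\<integral>\<^sup>+\<omega>. ennreal (real (N \<omega>) ^ 2 - real (N \<omega>)) \<partial>M)
        = (\<integral>\<^sup>+\<omega>. of_nat (card (distinct_tuples 2 (Z \<omega> \<inter> B))) \<partial>M)"
    proof (rule nn_integral_cong)
      fix \<omega> assume "\<omega> \<in> space M"
      then have "real (card (distinct_tuples 2 (Z \<omega> \<inter> B))) + real (N \<omega>) = real (N \<omega>) ^ 2"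
        unfolding N_def by (metis card_distinct_tuples_2 fin of_nat_add of_nat_power)
      then have "real (N \<omega>) ^ 2 - real (N \<omega>) = real (card (distinct_tuples 2 (Z \<omega> \<inter> B)))"
        by simp
      then show "ennreal (real (N \<omega>) ^ 2 - real (N \<omega>)) = of_nat (card (distinct_tuples 2 (Z \<omega> \<inter> B)))"
        by (simp add: ennreal_of_nat_eq_real_of_nat)
    qed
    also have "\<dots> = (\<integral>\<^sup>+x\<in>{..<2::nat} \<rightarrow>\<^sub>E B. ennreal (?\<rho> (x 0) (x 1)) \<partial>area_power 2 D)"
      by (rule nn_integral_card_distinct_tuples[OF correlation_function_2 C B \<open>B \<subseteq> C\<close>])
    also have "\<dots> = (\<integral>\<^sup>+x. (\<lambda>z w. ennreal (?\<rho> z w) * indicator (B \<times> B) (z, w)) (x 0) (x 1)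
        \<partial>Pi\<^sub>M {0, 1} (\<lambda>_::nat. R))"
    proof -
      have two: "{..<2} = {0, 1::nat}" by auto
      show ?thesis
        unfolding area_power_def R_def[symmetric] two
      proof (rule nn_integral_cong)
        fix x assume "x \<in> space (Pi\<^sub>M {0, 1} (\<lambda>_::nat. R))"
        then have "x \<in> {0, 1} \<rightarrow>\<^sub>E B \<longleftrightarrow> (x 0, x 1) \<in> B \<times> B"
          by (auto simp: space_PiM PiE_iff)
        then show "ennreal (?\<rho> (x 0) (x 1)) * indicator ({0, 1} \<rightarrow>\<^sub>E B) x
            = ennreal (?\<rho> (x 0) (x 1)) * indicator (B \<times> B) (x 0, x 1)"
          by (simp only: indicator_def)
      qed
    qed
    also have "\<dots> = (\<integral>\<^sup>+p. ennreal (?\<rho> (fst p) (snd p)) * indicator (B \<times> B) p \<partial>(R \<Otimes>\<^sub>M R))"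
      by (subst RR.product_nn_integral_pair) (auto simp: split_beta)
    finally have N2: "(\<integral>\<^sup>+\<omega>. ennreal (real (N \<omega>) ^ 2 - real (N \<omega>)) \<partial>M) = \<dots>" .

    have "ennreal v = (\<integral>\<^sup>+z. (\<integral>\<^sup>+w. ennreal ((cmod (K z w))\<^sup>2) * indicator (B \<times> B) (z, w) \<partial>R) \<partial>R)"
      unfolding v(1)[symmetric] R_int[symmetric]
      by (intro nn_integral_cong) (auto simp: indicator_times split: split_indicator)
    also have "\<dots> = (\<integral>\<^sup>+p. ennreal ((cmod (K (fst p) (snd p)))\<^sup>2) * indicator (B \<times> B) p \<partial>(R \<Otimes>\<^sub>M R))"
      by (subst R.nn_integral_fst[symmetric]) auto
    finally have V: "ennreal v = \<dots>" .

    have "ennreal (m\<^sup>2) = (\<integral>\<^sup>+z\<in>B. ennreal (Re (K z z)) \<partial>R) * (\<integral>\<^sup>+w\<in>B. ennreal (Re (K w w)) \<partial>R)"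
      using m by (simp add: R_int power2_eq_square ennreal_mult)
    also have "\<dots> = (\<integral>\<^sup>+z. (\<integral>\<^sup>+w. (ennreal (Re (K z z)) * indicator B z)
        * (ennreal (Re (K w w)) * indicator B w) \<partial>R) \<partial>R)"
      by (simp add: nn_integral_cmult nn_integral_multc)
    also have "\<dots> = (\<integral>\<^sup>+z. (\<integral>\<^sup>+w. ennreal (Re (K z z)) * ennreal (Re (K w w))
        * indicator (B \<times> B) (z, w) \<partial>R) \<partial>R)"
      by (intro nn_integral_cong) (auto split: split_indicator)
    also have "\<dots> = (\<integral>\<^sup>+p. ennreal (Re (K (fst p) (fst p))) * ennreal (Re (K (snd p) (snd p)))
        * indicator (B \<times> B) p \<partial>(R \<Otimes>\<^sub>M R))"
      by (subst R.nn_integral_fst[symmetric]) auto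
    also have "\<dots> = (\<integral>\<^sup>+p. ennreal (?\<rho> (fst p) (snd p)) * indicator (B \<times> B) p
        + ennreal ((cmod (K (fst p) (snd p)))\<^sup>2) * indicator (B \<times> B) p \<partial>(R \<Otimes>\<^sub>M R))"
    proof (rule nn_integral_cong)
      fix p assume "p \<in> space (R \<Otimes>\<^sub>M R)"
      then obtain z w where p: "p = (z, w)" "z \<in> D" "w \<in> D"
        by (auto simp: space_pair_measure spR)
      have "(\<lambda>i\<in>{..<2::nat}. if i = 0 then z else w) \<in> {..<2} \<rightarrow>\<^sub>E D"
        using p by auto
      moreover have "\<forall>x \<in> {..<2::nat} \<rightarrow>\<^sub>E D. 0 \<le> ?\<rho> (x 0) (x 1)"
        using correlation_function_2 unfolding correlation_function_def by blast
      ultimately have "0 \<le> ?\<rho> z w"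
        by fastforce
      then show "ennreal (Re (K (fst p) (fst p))) * ennreal (Re (K (snd p) (snd p))) * indicator (B \<times> B) p
        = ennreal (?\<rho> (fst p) (snd p)) * indicator (B \<times> B) p
          + ennreal ((cmod (K (fst p) (snd p)))\<^sup>2) * indicator (B \<times> B) p"
        using determinant_2[OF p(2,3)] kernel_diagonal(2)[OF p(2)] kernel_diagonal(2)[OF p(3)]
        by (simp add: p(1) flip: distrib_right ennreal_mult ennreal_plus del: minus_complex.sel)
    qed
    also have "\<dots> = (\<integral>\<^sup>+\<omega>. ennreal (real (N \<omega>) ^ 2 - real (N \<omega>)) \<partial>M) + ennreal v"
      unfolding N2 V by (rule nn_integral_add) auto
    finally show ?thesis ..
  qed

  obtain p where p: "(\<integral>\<^sup>+\<omega>. ennreal (real (N \<omega>) ^ 2 - real (N \<omega>)) \<partial>M) = ennreal p" "0 \<le> p"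
    using E2 by (cases "\<integral>\<^sup>+\<omega>. ennreal (real (N \<omega>) ^ 2 - real (N \<omega>)) \<partial>M") auto
  have pv: "p + v = m\<^sup>2"
    using E2 p v(2) by (simp flip: ennreal_plus)
  have "(\<integral>\<^sup>+\<omega>. ennreal (real (N \<omega>) ^ 2) \<partial>M)
      = (\<integral>\<^sup>+\<omega>. ennreal (real (N \<omega>) ^ 2 - real (N \<omega>)) + ennreal (real (N \<omega>)) \<partial>M)"
  proof (intro nn_integral_cong)
    fix \<omega>
    have "N \<omega> \<le> N \<omega> ^ 2" by (simp add: power2_eq_square)
    then have "real (N \<omega>) \<le> real (N \<omega>) ^ 2" by (metis of_nat_le_iff of_nat_power)
    then show "ennreal (real (N \<omega>) ^ 2) = ennreal (real (N \<omega>) ^ 2 - real (N \<omega>)) + ennreal (real (N \<omega>))"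
      by (simp flip: ennreal_plus)
  qed
  also have "\<dots> = ennreal (p + m)"
    by (subst nn_integral_add) (auto simp: p EN m)
  finally have EN2: "(\<integral>\<^sup>+\<omega>. ennreal (real (N \<omega>) ^ 2) \<partial>M) = ennreal (p + m)" .
  have "has_bochner_integral M (\<lambda>\<omega>. real (N \<omega>)) m"
    using EN m(2) by (intro has_bochner_integral_nn_integral) auto
  moreover have "has_bochner_integral M (\<lambda>\<omega>. (real (N \<omega>))\<^sup>2) (p + m)"
    using EN2 m(2) p(2) by (intro has_bochner_integral_nn_integral) auto
  ultimately have "variance (\<lambda>\<omega>. real (N \<omega>)) = p + m - m\<^sup>2"
    by (subst variance_eq) (auto simp: has_bochner_integral_iff)
  then show ?thesis using pv by (simp add: N_def)
qed

end

section \<open>Elementary integrals\<close>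

text \<open>
  Lebesgue measure on \<open>\<complex>\<close> is determined by the areas of boxes, and on boxes it agrees with the product
  of two copies of Lebesgue measure on the line.
\<close>

lemma distr_Complex_lborel:
  "distr (lborel \<Otimes>\<^sub>M lborel) borel (\<lambda>(x, y). Complex x y) = lborel"
proof (rule lborel_eqI[symmetric])
  have [measurable]: "(\<lambda>(x, y). Complex x y) \<in> borel_measurable (lborel \<Otimes>\<^sub>M lborel)"
    unfolding split_beta Complex_eq by measurable
  fix l u :: complex
  assume le: "\<And>b. b \<in> Basis \<Longrightarrow> l \<bullet> b \<le> u \<bullet> b"
  have "Re l \<le> Re u" "Im l \<le> Im u"
    using le[of 1] le[of \<i>] by (auto simp: Basis_complex_def)
  moreover have "(\<lambda>(x, y). Complex x y) -` box l u \<inter> space (lborel \<Otimes>\<^sub>M lborel)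
      = {Re l<..<Re u} \<times> {Im l<..<Im u}"
    by (auto simp: in_box_complex_iff space_pair_measure)
  ultimately show "emeasure (distr (lborel \<Otimes>\<^sub>M lborel) borel (\<lambda>(x, y). Complex x y)) (box l u)
      = (\<Prod>b\<in>Basis. (u - l) \<bullet> b)"
    by (simp add: emeasure_distr lborel.emeasure_pair_measure_Times Basis_complex_def ennreal_mult)
qed simp

lemma nn_integral_lborel_complex:
  assumes [measurable]: "f \<in> borel_measurable borel"
  shows "(\<integral>\<^sup>+z. f z \<partial>lborel) = (\<integral>\<^sup>+y. \<integral>\<^sup>+x. f (Complex x y) \<partial>lborel \<partial>lborel)"
proof -
  have [measurable]: "(\<lambda>(x, y). Complex x y) \<in> borel_measurable (lborel \<Otimes>\<^sub>M lborel)"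
    unfolding split_beta Complex_eq by measurable
  have "(\<integral>\<^sup>+z. f z \<partial>lborel) = (\<integral>\<^sup>+p. f (Complex (fst p) (snd p)) \<partial>(lborel \<Otimes>\<^sub>M lborel))"
    by (subst distr_Complex_lborel[symmetric], subst nn_integral_distr) (auto simp: split_beta)
  also have "\<dots> = (\<integral>\<^sup>+y. \<integral>\<^sup>+x. f (Complex x y) \<partial>lborel \<partial>lborel)"
    by (subst lborel_pair.nn_integral_snd[symmetric]) (auto simp: Complex_eq)
  finally show ?thesis .
qed

text \<open>
  If \<open>G'' = f\<close>, then \<open>\<partial>\<^sub>x\<partial>\<^sub>y G(x + \<sigma> y) = \<sigma> f(x + \<sigma> y)\<close>, and \<open>\<sigma> = \<plusminus>1\<close> is its own inverse, so the integral is
  \<open>\<sigma>\<close> times the alternating sum of \<open>G\<close> over the corners.  Both signs occur below: the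
  kernel depends on the difference of the real parts and on the sum of the imaginary parts.
\<close>

lemma nn_integral_second_difference:
  fixes f F G :: "real \<Rightarrow> real" and a b c d \<sigma> :: real
  assumes [measurable]: "f \<in> borel_measurable borel" "F \<in> borel_measurable borel"
    and \<sigma>: "\<sigma> = 1 \<or> \<sigma> = - 1" and "a \<le> b" "c \<le> d"
    and G: "\<And>x y. x \<in> {a..b} \<Longrightarrow> y \<in> {c..d} \<Longrightarrow> (G has_real_derivative F (x + \<sigma> * y)) (at (x + \<sigma> * y))"
    and F: "\<And>x y. x \<in> {a..b} \<Longrightarrow> y \<in> {c..d} \<Longrightarrow> (F has_real_derivative f (x + \<sigma> * y)) (at (x + \<sigma> * y))"
    and nonneg: "\<And>x y. x \<in> {a..b} \<Longrightarrow> y \<in> {c..d} \<Longrightarrow> 0 \<le> f (x + \<sigma> * y)"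
  shows "(\<integral>\<^sup>+x\<in>{a..b}. (\<integral>\<^sup>+y\<in>{c..d}. ennreal (f (x + \<sigma> * y)) \<partial>lborel) \<partial>lborel)
    = ennreal (\<sigma> * (G (b + \<sigma> * d) - G (b + \<sigma> * c) - G (a + \<sigma> * d) + G (a + \<sigma> * c)))" (is ?integral)
    and "0 \<le> \<sigma> * (G (b + \<sigma> * d) - G (b + \<sigma> * c) - G (a + \<sigma> * d) + G (a + \<sigma> * c))" (is ?nonneg)
proof -
  define H where "H x = \<sigma> * F (x + \<sigma> * d) - \<sigma> * F (x + \<sigma> * c)" for x
  have inner: "(\<integral>\<^sup>+y\<in>{c..d}. ennreal (f (x + \<sigma> * y)) \<partial>lborel) = ennreal (H x)" "0 \<le> H x"
    if x: "x \<in> {a..b}" for x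
  proof -
    have der: "((\<lambda>y. \<sigma> * F (x + \<sigma> * y)) has_real_derivative f (x + \<sigma> * y)) (at y)"
      if "y \<in> {c..d}" for y
    proof -
      have "((\<lambda>y. x + \<sigma> * y) has_real_derivative \<sigma>) (at y)"
        by (auto intro!: derivative_eq_intros)
      from DERIV_cmult[OF DERIV_chain2[where g = "\<lambda>y. x + \<sigma> * y", OF F[OF x that] this], of \<sigma>]
      show ?thesis using \<sigma> by auto
    qed
    show "(\<integral>\<^sup>+y\<in>{c..d}. ennreal (f (x + \<sigma> * y)) \<partial>lborel) = ennreal (H x)"
      unfolding H_def using nonneg[OF x] \<open>c \<le> d\<close>
      by (intro nn_integral_FTC_Icc der) auto
    have "\<sigma> * F (x + \<sigma> * c) \<le> \<sigma> * F (x + \<sigma> * d)"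
      by (rule DERIV_nonneg_imp_nondecreasing[OF \<open>c \<le> d\<close>]) (use der nonneg[OF x] in force)
    then show "0 \<le> H x" by (simp add: H_def)
  qed
  have shift: "((\<lambda>x. G (x + \<sigma> * y)) has_real_derivative F (x + \<sigma> * y)) (at x)"
    if "x \<in> {a..b}" "y \<in> {c..d}" for x y
  proof -
    have "((\<lambda>x. x + \<sigma> * y) has_real_derivative 1) (at x)"
      by (auto intro!: derivative_eq_intros)
    from DERIV_chain2[where g = "\<lambda>x. x + \<sigma> * y", OF G[OF that] this] show ?thesis by simp
  qed
  have der: "((\<lambda>x. \<sigma> * G (x + \<sigma> * d) - \<sigma> * G (x + \<sigma> * c)) has_real_derivative H x) (at x)"
    if "x \<in> {a..b}" for x
    unfolding H_def using \<open>c \<le> d\<close> by (intro DERIV_diff DERIV_cmult shift that) auto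
  have "(\<integral>\<^sup>+x\<in>{a..b}. ennreal (H x) \<partial>lborel) =
      ennreal ((\<sigma> * G (b + \<sigma> * d) - \<sigma> * G (b + \<sigma> * c)) - (\<sigma> * G (a + \<sigma> * d) - \<sigma> * G (a + \<sigma> * c)))"
    using inner(2) \<open>a \<le> b\<close> by (intro nn_integral_FTC_Icc der) (auto simp: H_def)
  moreover have "(\<integral>\<^sup>+x\<in>{a..b}. (\<integral>\<^sup>+y\<in>{c..d}. ennreal (f (x + \<sigma> * y)) \<partial>lborel) \<partial>lborel)
      = (\<integral>\<^sup>+x\<in>{a..b}. ennreal (H x) \<partial>lborel)"
    by (intro nn_integral_cong) (auto simp: inner split: split_indicator)
  ultimately show ?integral by (simp add: algebra_simps)
  have "\<sigma> * G (a + \<sigma> * d) - \<sigma> * G (a + \<sigma> * c) \<le> \<sigma> * G (b + \<sigma> * d) - \<sigma> * G (b + \<sigma> * c)"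
    by (rule DERIV_nonneg_imp_nondecreasing[OF \<open>a \<le> b\<close>]) (use der inner(2) in force)
  then show ?nonneg by (simp add: algebra_simps)
qed

text \<open>
  The difference of the two sides has derivative \<open>1 / (1 + x\<^sup>2) - 1 + x\<^sup>2 = x\<^sup>4 / (1 + x\<^sup>2)\<close>.
\<close>

lemma arctan_ge_cubic:
  fixes t :: real assumes "0 \<le> t" shows "t - t ^ 3 / 3 \<le> arctan t"
proof -
  have "arctan 0 - (0 - 0 ^ 3 / 3) \<le> arctan t - (t - t ^ 3 / 3)"
  proof (rule DERIV_nonneg_imp_nondecreasing[OF assms])
    fix x :: real
    have "((\<lambda>x. arctan x - (x - x ^ 3 / 3)) has_real_derivative inverse (1 + x\<^sup>2) - (1 - x\<^sup>2)) (at x)"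
      by (auto intro!: derivative_eq_intros)
    moreover have "inverse (1 + x\<^sup>2) - (1 - x\<^sup>2) = x ^ 4 / (1 + x\<^sup>2)"
      by (simp add: field_simps add_nonneg_eq_0_iff)
    ultimately show "\<exists>y. ((\<lambda>x. arctan x - (x - x ^ 3 / 3)) has_real_derivative y) (at x) \<and> 0 \<le> y"
      by (intro exI[of _ "inverse (1 + x\<^sup>2) - (1 - x\<^sup>2)"]) (simp)
  qed
  then show ?thesis by simp
qed

text \<open>
  The second antiderivative \<open>G t = t arctan(t/s) / (2 s\<^sup>3)\<close> of \<open>1 / (t\<^sup>2 + s\<^sup>2)\<^sup>2\<close> is even and vanishes at
  \<open>0\<close>, so its second difference over \<open>[0,L]\<^sup>2\<close> reduces to \<open>2 G L\<close>.
\<close>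

lemma nn_integral_abscissae:
  fixes c s L :: real
  assumes "0 \<le> c" "0 < s" "0 \<le> L"
  shows "(\<integral>\<^sup>+x\<in>{0..L}. (\<integral>\<^sup>+u\<in>{0..L}. ennreal (c * (1 / ((x - u)\<^sup>2 + s\<^sup>2)\<^sup>2)) \<partial>lborel) \<partial>lborel)
    = ennreal (c * (L * arctan (L / s) / s ^ 3))"
proof -
  define f where "f t = 1 / (t\<^sup>2 + s\<^sup>2)\<^sup>2" for t
  define F where "F t = t / (2 * s\<^sup>2 * (t\<^sup>2 + s\<^sup>2)) + arctan (t / s) / (2 * s ^ 3)" for t
  define G where "G t = t * arctan (t / s) / (2 * s ^ 3)" for t
  have pos: "t\<^sup>2 + s\<^sup>2 > 0" for t
    using \<open>0 < s\<close> by (simp add: add_nonneg_pos)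
  have atn: "((\<lambda>t. arctan (t / s)) has_real_derivative s / (t\<^sup>2 + s\<^sup>2)) (at t)" for t
    using \<open>0 < s\<close> pos[of t]
    by (auto intro!: derivative_eq_intros simp: field_simps power2_eq_square)
  have F: "(F has_real_derivative f t) (at t)" for t
    unfolding F_def f_def using \<open>0 < s\<close> pos[of t]
    by (auto intro!: derivative_eq_intros atn simp: divide_simps)
       (simp add: algebra_simps power_numeral_reduce)
  have G: "(G has_real_derivative F t) (at t)" for t
    unfolding G_def F_def using \<open>0 < s\<close> pos[of t]
    by (auto intro!: derivative_eq_intros atn simp: divide_simps)
       (simp add: algebra_simps power_numeral_reduce)
  have "(\<integral>\<^sup>+x\<in>{0..L}. (\<integral>\<^sup>+u\<in>{0..L}. ennreal (c * f (x + (- 1) * u)) \<partial>lborel) \<partial>lborel)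
    = ennreal ((- 1) * (c * G (L + (- 1) * L) - c * G (L + (- 1) * 0) - c * G (0 + (- 1) * L) + c * G (0 + (- 1) * 0)))"
  proof (rule nn_integral_second_difference(1))
    show "(\<lambda>t. c * f t) \<in> borel_measurable borel"
      unfolding f_def by measurable
    show "(\<lambda>t. c * F t) \<in> borel_measurable borel"
      unfolding F_def by measurable
    show "((\<lambda>t. c * F t) has_real_derivative c * f (x + (- 1) * u)) (at (x + (- 1) * u))"
      "((\<lambda>t. c * G t) has_real_derivative c * F (x + (- 1) * u)) (at (x + (- 1) * u))" for x u
      by (intro DERIV_cmult F G)+
    show "0 \<le> c * f (x + (- 1) * u)" for x u
      using \<open>0 \<le> c\<close> by (simp add: f_def)
  qed (use assms in auto)
  also have "(- 1) * (c * G (L + (- 1) * L) - c * G (L + (- 1) * 0) - c * G (0 + (- 1) * L) + c * G (0 + (- 1) * 0))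
      = c * (L * arctan (L / s) / s ^ 3)"
    by (simp add: G_def arctan_minus)
  finally show ?thesis by (simp add: f_def)
qed

text \<open>
  The integrand is the large-\<open>L\<close> expansion of the preceding integral at \<open>s = y + v\<close>, with a constant
  \<open>e\<close> that will be \<open>0\<close> for the lower and \<open>1 / (3 L\<^sup>2)\<close> for the upper bound.  The condition
  \<open>2\<beta> \<le> L\<close> makes it nonnegative, so that it is a legitimate integrand in \<open>[0,\<infinity>]\<close>.
\<close>

lemma nn_integral_ordinates:
  fixes c e L \<alpha> \<beta> :: real
  assumes "0 \<le> c" "0 \<le> e" "0 < \<alpha>" "\<alpha> < \<beta>" "2 * \<beta> \<le> L"
  defines "J \<equiv> c * (L * pi / 8 * (\<beta> - \<alpha>)\<^sup>2 / (\<alpha> * \<beta> * (\<alpha> + \<beta>))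
                - ln ((\<alpha> + \<beta>)\<^sup>2 / (4 * \<alpha> * \<beta>)) + e * (\<beta> - \<alpha>)\<^sup>2)"
  shows "(\<integral>\<^sup>+y\<in>{\<alpha>..\<beta>}. (\<integral>\<^sup>+v\<in>{\<alpha>..\<beta>}.
      ennreal (c * (L * pi / (2 * (y + v) ^ 3) - 1 / (y + v)\<^sup>2 + e)) \<partial>lborel) \<partial>lborel) = ennreal J"
    and "0 \<le> J"
proof -
  define f where "f s = L * pi / (2 * s ^ 3) - 1 / s\<^sup>2 + e" for s
  define F where "F s = - (L * pi / (4 * s\<^sup>2)) + 1 / s + e * s" for s
  define p where "p s = L * pi / (4 * s)" for s
  define q where "q s = e * s\<^sup>2 / 2" for s
  define G where "G s = p s + ln s + q s" for s
  have F: "(F has_real_derivative f s) (at s)" if "0 < s" for s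
    unfolding F_def f_def using that
    by (auto intro!: derivative_eq_intros) (simp add: field_simps power_numeral_reduce)
  have G: "(G has_real_derivative F s) (at s)" if "0 < s" for s
    unfolding G_def p_def q_def F_def using that
    by (auto intro!: derivative_eq_intros) (simp add: field_simps power_numeral_reduce)
  have f0: "0 \<le> f s" if "0 < s" "s \<le> L" for s
  proof -
    have "s * 2 \<le> L * pi"
      using that pi_gt3 by (intro mult_mono) auto
    then have "1 / s\<^sup>2 \<le> L * pi / (2 * s ^ 3)"
      using that by (simp add: field_simps power_numeral_reduce)
    then show ?thesis using \<open>0 \<le> e\<close> by (simp add: f_def)
  qed
  have J: "1 * (c * G (\<beta> + 1 * \<beta>) - c * G (\<beta> + 1 * \<alpha>) - c * G (\<alpha> + 1 * \<beta>) + c * G (\<alpha> + 1 * \<alpha>)) = J"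
  proof -
    have "ln ((\<alpha> + \<beta>)\<^sup>2 / (4 * \<alpha> * \<beta>)) = ln ((\<alpha> + \<beta>)\<^sup>2 / ((2 * \<alpha>) * (2 * \<beta>)))" by (simp add: mult.assoc)
    also have "\<dots> = 2 * ln (\<alpha> + \<beta>) - (ln (2 * \<alpha>) + ln (2 * \<beta>))"
      using assms by (simp only: ln_divide_pos ln_mult_pos ln_realpow mult_pos_pos zero_less_power
          add_pos_pos zero_less_numeral order.strict_trans[OF \<open>0 < \<alpha>\<close> \<open>\<alpha> < \<beta>\<close>] of_nat_numeral)
    finally have ln: "ln ((\<alpha> + \<beta>)\<^sup>2 / (4 * \<alpha> * \<beta>)) = 2 * ln (\<alpha> + \<beta>) - (ln (2 * \<alpha>) + ln (2 * \<beta>))" .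
    have p: "p (2 * \<beta>) - 2 * p (\<alpha> + \<beta>) + p (2 * \<alpha>)
        = L * pi / 8 * (\<beta> - \<alpha>)\<^sup>2 / (\<alpha> * \<beta> * (\<alpha> + \<beta>))"
      using assms unfolding p_def
      by (simp add: divide_simps add_pos_pos) (simp add: algebra_simps power2_eq_square)
    have q: "q (2 * \<beta>) - 2 * q (\<alpha> + \<beta>) + q (2 * \<alpha>) = e * (\<beta> - \<alpha>)\<^sup>2"
      unfolding q_def by (simp add: field_simps power2_eq_square)
    have g: "G (2 * \<beta>) - 2 * G (\<alpha> + \<beta>) + G (2 * \<alpha>) =
        L * pi / 8 * (\<beta> - \<alpha>)\<^sup>2 / (\<alpha> * \<beta> * (\<alpha> + \<beta>))
                - ln ((\<alpha> + \<beta>)\<^sup>2 / (4 * \<alpha> * \<beta>)) + e * (\<beta> - \<alpha>)\<^sup>2"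
      unfolding ln G_def p[symmetric] q[symmetric] by simp
    show ?thesis
      unfolding J_def g[symmetric]
      by (simp add: add.commute[of \<beta> \<alpha>] flip: mult_2) (simp add: algebra_simps)
  qed
  have [measurable]: "(\<lambda>t. c * f t) \<in> borel_measurable borel" "(\<lambda>t. c * F t) \<in> borel_measurable borel"
    unfolding f_def F_def by measurable
  have *: "(\<integral>\<^sup>+y\<in>{\<alpha>..\<beta>}. (\<integral>\<^sup>+v\<in>{\<alpha>..\<beta>}. ennreal (c * f (y + 1 * v)) \<partial>lborel) \<partial>lborel)
    = ennreal (1 * (c * G (\<beta> + 1 * \<beta>) - c * G (\<beta> + 1 * \<alpha>) - c * G (\<alpha> + 1 * \<beta>) + c * G (\<alpha> + 1 * \<alpha>)))"
    "0 \<le> 1 * (c * G (\<beta> + 1 * \<beta>) - c * G (\<beta> + 1 * \<alpha>) - c * G (\<alpha> + 1 * \<beta>) + c * G (\<alpha> + 1 * \<alpha>))"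
    by (rule nn_integral_second_difference[where F = "\<lambda>s. c * F s" and f = "\<lambda>s. c * f s"];
      use assms in \<open>auto intro!: DERIV_cmult F G mult_nonneg_nonneg f0\<close>)+
  from *(1) show "(\<integral>\<^sup>+y\<in>{\<alpha>..\<beta>}. (\<integral>\<^sup>+v\<in>{\<alpha>..\<beta>}.
      ennreal (c * (L * pi / (2 * (y + v) ^ 3) - 1 / (y + v)\<^sup>2 + e)) \<partial>lborel) \<partial>lborel) = ennreal J"
    unfolding J by (simp add: f_def)
  from *(2) show "0 \<le> J" unfolding J .
qed

text \<open>
  Write \<open>arctan(L/s) = \<pi>/2 - arctan(s/L)\<close> and enclose \<open>arctan(s/L)\<close> between its Taylor polynomials
  of degrees one and three.
\<close>

lemma abscissae_integral_bounds:
  fixes s L :: real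
  assumes "0 < s" "0 < L"
  shows "L * pi / (2 * s ^ 3) - 1 / s\<^sup>2 \<le> L * arctan (L / s) / s ^ 3"
    and "L * arctan (L / s) / s ^ 3 \<le> L * pi / (2 * s ^ 3) - 1 / s\<^sup>2 + 1 / (3 * L\<^sup>2)"
proof -
  have "arctan (L / s) = pi / 2 - arctan (s / L)"
    using assms arctan_inverse[of "s / L"] by simp
  then have eq: "L * arctan (L / s) / s ^ 3 = L * pi / (2 * s ^ 3) - L * arctan (s / L) / s ^ 3"
    by (simp add: right_diff_distrib diff_divide_distrib)
  have "L * arctan (s / L) / s ^ 3 \<le> L * (s / L) / s ^ 3"
    using assms by (intro divide_right_mono mult_left_mono arctan_le_self) auto
  also have "\<dots> = 1 / s\<^sup>2"
    using assms by (simp add: field_simps power_numeral_reduce)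
  finally show "L * pi / (2 * s ^ 3) - 1 / s\<^sup>2 \<le> L * arctan (L / s) / s ^ 3"
    unfolding eq by simp
  have "1 / s\<^sup>2 - 1 / (3 * L\<^sup>2) = L * (s / L - (s / L) ^ 3 / 3) / s ^ 3"
    using assms by (simp add: field_simps power_numeral_reduce)
  also have "\<dots> \<le> L * arctan (s / L) / s ^ 3"
    using assms by (intro divide_right_mono mult_left_mono arctan_ge_cubic) auto
  finally show "L * arctan (L / s) / s ^ 3 \<le> L * pi / (2 * s ^ 3) - 1 / s\<^sup>2 + 1 / (3 * L\<^sup>2)"
    unfolding eq by simp
qed

section \<open>The half-plane kernel on a rectangle\<close>

lemma half_plane_kernel_diagonal: "Re (K_half_plane z z) = 1 / (4 * pi) * (1 / (Im z)\<^sup>2)"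
proof -
  have "z - cnj z = of_real (2 * Im z) * \<i>" by (simp add: complex_eq_iff)
  then have "K_half_plane z z = of_real (1 / (4 * pi) * (1 / (Im z)\<^sup>2))"
    by (simp add: K_half_plane_def power_mult_distrib)
  then show ?thesis by simp
qed

lemma half_plane_kernel_square:
  "(cmod (K_half_plane z w))\<^sup>2 = 1 / pi\<^sup>2 * (1 / ((Re z - Re w)\<^sup>2 + (Im z + Im w)\<^sup>2)\<^sup>2)"
proof -
  have "(cmod (K_half_plane z w))\<^sup>2 = 1 / (pi\<^sup>2 * ((cmod (z - cnj w))\<^sup>2)\<^sup>2)"
    by (simp add: K_half_plane_def norm_divide norm_mult norm_power power_divide power_mult_distrib)
  also have "(cmod (z - cnj w))\<^sup>2 = (Re z - Re w)\<^sup>2 + (Im z + Im w)\<^sup>2"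
    by (simp add: cmod_power2)
  finally show ?thesis by simp
qed

lemma half_plane_kernel_measurable [measurable]:
  "(\<lambda>(z, w). K_half_plane z w) \<in> borel_measurable (borel \<Otimes>\<^sub>M borel)"
proof -
  have [measurable]: "cnj \<in> borel_measurable borel"
    by (intro borel_measurable_continuous_onI continuous_intros)
  show ?thesis unfolding K_half_plane_def split_beta by measurable
qed

lemma half_plane_mean_integral:
  fixes L \<alpha> \<beta> :: real
  assumes "0 < \<alpha>" "\<alpha> < \<beta>" "0 \<le> L"
  shows "(\<integral>\<^sup>+z\<in>cbox (Complex 0 \<alpha>) (Complex L \<beta>). ennreal (Re (K_half_plane z z)) \<partial>lborel)
    = ennreal (L / (4 * pi) * (1 / \<alpha> - 1 / \<beta>))"
proof -
  have "(\<integral>\<^sup>+z\<in>cbox (Complex 0 \<alpha>) (Complex L \<beta>). ennreal (Re (K_half_plane z z)) \<partial>lborel)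
    = (\<integral>\<^sup>+y. \<integral>\<^sup>+x. (ennreal (1 / (4 * pi) * (1 / y\<^sup>2)) * indicator {\<alpha>..\<beta>} y) * indicator {0..L} x
        \<partial>lborel \<partial>lborel)"
    unfolding half_plane_kernel_diagonal
    by (subst nn_integral_lborel_complex)
      (auto intro!: nn_integral_cong simp: in_cbox_complex_iff split: split_indicator)
  also have "\<dots> = (\<integral>\<^sup>+y. ennreal L * (ennreal (1 / (4 * pi) * (1 / y\<^sup>2)) * indicator {\<alpha>..\<beta>} y) \<partial>lborel)"
    using assms by (intro nn_integral_cong, subst nn_integral_cmult) (auto simp: mult.commute)
  also have "\<dots> = ennreal L * (\<integral>\<^sup>+y\<in>{\<alpha>..\<beta>}. ennreal (1 / (4 * pi) * (1 / y\<^sup>2)) \<partial>lborel)"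
    by (rule nn_integral_cmult) auto
  also have "(\<integral>\<^sup>+y\<in>{\<alpha>..\<beta>}. ennreal (1 / (4 * pi) * (1 / y\<^sup>2)) \<partial>lborel)
      = ennreal (- (1 / (4 * pi) * (1 / \<beta>)) - - (1 / (4 * pi) * (1 / \<alpha>)))"
    using assms by (intro nn_integral_FTC_Icc)
      (auto intro!: derivative_eq_intros simp: field_simps power2_eq_square)
  also have "ennreal L * \<dots> = ennreal (L / (4 * pi) * (1 / \<alpha> - 1 / \<beta>))"
    using assms by (subst ennreal_mult[symmetric]) (auto simp: field_simps)
  finally show ?thesis .
qed

text \<open>
  Tonelli's theorem moves the two real parts innermost, where their integral has the closed form of
  \<open>nn_integral_abscissae\<close>.
\<close>

lemma half_plane_square_integral:
  fixes L \<alpha> \<beta> :: real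
  assumes "0 < \<alpha>" "\<alpha> < \<beta>" "0 \<le> L"
  defines "B \<equiv> cbox (Complex 0 \<alpha>) (Complex L \<beta>)"
  shows "(\<integral>\<^sup>+z\<in>B. (\<integral>\<^sup>+w\<in>B. ennreal ((cmod (K_half_plane z w))\<^sup>2) \<partial>lborel) \<partial>lborel)
    = (\<integral>\<^sup>+y\<in>{\<alpha>..\<beta>}. (\<integral>\<^sup>+v\<in>{\<alpha>..\<beta>}.
        ennreal (1 / pi\<^sup>2 * (L * arctan (L / (y + v)) / (y + v) ^ 3)) \<partial>lborel) \<partial>lborel)"
proof -
  let ?g = "\<lambda>x y u v. ennreal (1 / pi\<^sup>2 * (1 / ((x - u)\<^sup>2 + (y + v)\<^sup>2)\<^sup>2))"
  define h where "h z w = ?g (Re z) (Im z) (Re w) (Im w) * indicator B w" for z w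
  have [measurable]: "B \<in> sets borel" by (simp add: B_def)
  have [measurable]: "(\<lambda>(z, w). h z w) \<in> borel_measurable (borel \<Otimes>\<^sub>M borel)"
    unfolding h_def split_beta by measurable
  have "(\<integral>\<^sup>+z\<in>B. (\<integral>\<^sup>+w\<in>B. ennreal ((cmod (K_half_plane z w))\<^sup>2) \<partial>lborel) \<partial>lborel)
    = (\<integral>\<^sup>+z\<in>B. (\<integral>\<^sup>+w. h z w \<partial>lborel) \<partial>lborel)"
    unfolding half_plane_kernel_square h_def ..
  also have "\<dots> = (\<integral>\<^sup>+y. \<integral>\<^sup>+x. (\<integral>\<^sup>+w. h (Complex x y) w \<partial>lborel) * indicator B (Complex x y)
      \<partial>lborel \<partial>lborel)"
    by (rule nn_integral_lborel_complex) measurable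
  also have "\<dots> = (\<integral>\<^sup>+y. \<integral>\<^sup>+x. (\<integral>\<^sup>+v. \<integral>\<^sup>+u. h (Complex x y) (Complex u v) \<partial>lborel \<partial>lborel)
      * indicator B (Complex x y) \<partial>lborel \<partial>lborel)"
  proof -
    have "(\<integral>\<^sup>+w. h z w \<partial>lborel) = (\<integral>\<^sup>+v. \<integral>\<^sup>+u. h z (Complex u v) \<partial>lborel \<partial>lborel)" for z
      by (rule nn_integral_lborel_complex) measurable
    then show ?thesis by simp
  qed
  also have "\<dots> = (\<integral>\<^sup>+y. \<integral>\<^sup>+x. \<integral>\<^sup>+v. \<integral>\<^sup>+u. ?g x y u v * indicator {0..L} u * indicator {0..L} x
      * indicator {\<alpha>..\<beta>} v * indicator {\<alpha>..\<beta>} y \<partial>lborel \<partial>lborel \<partial>lborel \<partial>lborel)"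
    by (intro nn_integral_cong) (auto simp: h_def B_def in_cbox_complex_iff intro!: nn_integral_cong split: split_indicator)
  also have "\<dots> = (\<integral>\<^sup>+y. \<integral>\<^sup>+v. \<integral>\<^sup>+x. \<integral>\<^sup>+u. ?g x y u v * indicator {0..L} u * indicator {0..L} x
      * indicator {\<alpha>..\<beta>} v * indicator {\<alpha>..\<beta>} y \<partial>lborel \<partial>lborel \<partial>lborel \<partial>lborel)"
    by (intro nn_integral_cong lborel_pair.Fubini') measurable
  also have "\<dots> = (\<integral>\<^sup>+y\<in>{\<alpha>..\<beta>}. (\<integral>\<^sup>+v\<in>{\<alpha>..\<beta>}. (\<integral>\<^sup>+x\<in>{0..L}. (\<integral>\<^sup>+u\<in>{0..L}. ?g x y u v
      \<partial>lborel) \<partial>lborel) \<partial>lborel) \<partial>lborel)"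
    by (simp add: nn_integral_multc)
  also have "\<dots> = (\<integral>\<^sup>+y\<in>{\<alpha>..\<beta>}. (\<integral>\<^sup>+v\<in>{\<alpha>..\<beta>}.
        ennreal (1 / pi\<^sup>2 * (L * arctan (L / (y + v)) / (y + v) ^ 3)) \<partial>lborel) \<partial>lborel)"
  proof -
    have "(\<integral>\<^sup>+x\<in>{0..L}. (\<integral>\<^sup>+u\<in>{0..L}. ?g x y u v \<partial>lborel) \<partial>lborel)
      = ennreal (1 / pi\<^sup>2 * (L * arctan (L / (y + v)) / (y + v) ^ 3))"
      if "y \<in> {\<alpha>..\<beta>}" "v \<in> {\<alpha>..\<beta>}" for y v
      using that assms by (intro nn_integral_abscissae) auto
    then show ?thesis
      by (intro nn_integral_cong)
        (auto intro!: nn_integral_cong split: split_indicator)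
  qed
  finally show ?thesis .
qed

lemma nn_set_integral_mono_pointwise:
  assumes "\<And>x. x \<in> A \<Longrightarrow> f x \<le> g x"
  shows "(\<integral>\<^sup>+x\<in>A. f x \<partial>M) \<le> (\<integral>\<^sup>+x\<in>A. g x \<partial>M)"
  using assms by (intro nn_integral_mono) (auto split: split_indicator)

text \<open>
  Only the integral over the imaginary parts is estimated; the uniform error \<open>1 / (3 L\<^sup>2)\<close> is
  multiplied by the area of \<open>[\<alpha>,\<beta>]\<^sup>2\<close>.
\<close>

lemma half_plane_square_integral_bounds:
  fixes L \<alpha> \<beta> :: real
  assumes "0 < \<alpha>" "\<alpha> < \<beta>" "2 * \<beta> \<le> L"
  defines "B \<equiv> cbox (Complex 0 \<alpha>) (Complex L \<beta>)"
    and "J \<equiv> 1 / pi\<^sup>2 * (L * pi / 8 * (\<beta> - \<alpha>)\<^sup>2 / (\<alpha> * \<beta> * (\<alpha> + \<beta>))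
                - ln ((\<alpha> + \<beta>)\<^sup>2 / (4 * \<alpha> * \<beta>)))"
  obtains v where "0 \<le> v" "J \<le> v" "v \<le> J + (\<beta> - \<alpha>)\<^sup>2 / (3 * pi\<^sup>2 * L\<^sup>2)"
    "(\<integral>\<^sup>+z\<in>B. (\<integral>\<^sup>+w\<in>B. ennreal ((cmod (K_half_plane z w))\<^sup>2) \<partial>lborel) \<partial>lborel) = ennreal v"
proof -
  let ?V = "\<integral>\<^sup>+z\<in>B. (\<integral>\<^sup>+w\<in>B. ennreal ((cmod (K_half_plane z w))\<^sup>2) \<partial>lborel) \<partial>lborel"
  let ?I = "\<lambda>e. (\<integral>\<^sup>+y\<in>{\<alpha>..\<beta>}. (\<integral>\<^sup>+v\<in>{\<alpha>..\<beta>}.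
      ennreal (1 / pi\<^sup>2 * (L * pi / (2 * (y + v) ^ 3) - 1 / (y + v)\<^sup>2 + e)) \<partial>lborel) \<partial>lborel)"
  let ?e = "1 / (3 * L\<^sup>2)"
  have "0 < L" using assms by simp
  have V: "?V = (\<integral>\<^sup>+y\<in>{\<alpha>..\<beta>}. (\<integral>\<^sup>+v\<in>{\<alpha>..\<beta>}.
        ennreal (1 / pi\<^sup>2 * (L * arctan (L / (y + v)) / (y + v) ^ 3)) \<partial>lborel) \<partial>lborel)"
    unfolding B_def using assms by (intro half_plane_square_integral) auto
  have bounds: "L * pi / (2 * (y + v) ^ 3) - 1 / (y + v)\<^sup>2 + 0 \<le> L * arctan (L / (y + v)) / (y + v) ^ 3"
      "L * arctan (L / (y + v)) / (y + v) ^ 3 \<le> L * pi / (2 * (y + v) ^ 3) - 1 / (y + v)\<^sup>2 + ?e"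
    if "y \<in> {\<alpha>..\<beta>}" "v \<in> {\<alpha>..\<beta>}" for y v
    using abscissae_integral_bounds[of "y + v" L] that \<open>0 < \<alpha>\<close> \<open>0 < L\<close> by auto
  have "?I 0 \<le> ?V" unfolding V
    by (intro nn_set_integral_mono_pointwise ennreal_leI mult_left_mono bounds) auto
  moreover have "?V \<le> ?I ?e" unfolding V
    by (intro nn_set_integral_mono_pointwise ennreal_leI mult_left_mono bounds) auto
  moreover have "?I 0 = ennreal J"
    using nn_integral_ordinates(1)[of "1 / pi\<^sup>2" 0 \<alpha> \<beta> L] assms by (simp add: J_def)
  moreover have "J + (\<beta> - \<alpha>)\<^sup>2 / (3 * pi\<^sup>2 * L\<^sup>2) =
     1 / pi\<^sup>2 * (L * pi / 8 * (\<beta> - \<alpha>)\<^sup>2 / (\<alpha> * \<beta> * (\<alpha> + \<beta>))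
                - ln ((\<alpha> + \<beta>)\<^sup>2 / (4 * \<alpha> * \<beta>)) + ?e * (\<beta> - \<alpha>)\<^sup>2)"
    using \<open>0 < L\<close> unfolding J_def by (simp add: ring_distribs)
  moreover from this have "?I ?e = ennreal (J + (\<beta> - \<alpha>)\<^sup>2 / (3 * pi\<^sup>2 * L\<^sup>2))"
      and "0 \<le> J + (\<beta> - \<alpha>)\<^sup>2 / (3 * pi\<^sup>2 * L\<^sup>2)"
    using nn_integral_ordinates[of "1 / pi\<^sup>2" ?e \<alpha> \<beta> L] assms by simp_all
  ultimately show thesis
    by (cases ?V) (auto intro!: that simp: ennreal_le_iff top_unique)
qed

section \<open>Asymptotics of the variance\<close>

text \<open>
  The mean \<open>m\<close> and the part of the main term \<open>J\<close> that is linear in \<open>L\<close> are \<open>L / (8 \<pi> \<alpha>)\<close> times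
  \<open>2 (a-1) / a\<close> and \<open>(a-1)\<^sup>2 / (a (a+1))\<close>; the difference of these two fractions is
  \<open>(a-1) (a+3) / (a (a+1))\<close>.
\<close>

lemma half_plane_variance_estimate:
  fixes M :: "'w measure" and Z :: "'w \<Rightarrow> complex set" and \<alpha> \<beta> L :: real
  assumes "determinantal_process M upper_half_plane Z K_half_plane"
    and "0 < \<alpha>" "\<alpha> < \<beta>" "2 * \<beta> \<le> L"
  defines "a \<equiv> \<beta> / \<alpha>"
  shows "\<bar>prob_space.variance M (point_count Z {\<alpha>..\<beta>} L)
      - (L * (1 / \<alpha>) * ((a - 1) * (a + 3) / (8 * pi * a * (a + 1)))
         + 1 / pi\<^sup>2 * ln ((a + 1)\<^sup>2 / (4 * a)))\<bar> \<le> (\<beta> - \<alpha>)\<^sup>2 / (3 * pi\<^sup>2 * L\<^sup>2)"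
proof -
  interpret determinantal_process M upper_half_plane Z K_half_plane by fact
  define B where "B = cbox (Complex 0 \<alpha>) (Complex L \<beta>)"
  define R where "R = restrict_space (lborel :: complex measure) upper_half_plane"
  have B: "compact B" "B \<subseteq> upper_half_plane" "B \<in> sets borel"
    using \<open>0 < \<alpha>\<close> by (auto simp: B_def in_cbox_complex_iff upper_half_plane_def)
  have count: "point_count Z {\<alpha>..\<beta>} L = (\<lambda>\<omega>. real (card (Z \<omega> \<inter> B)))"
    unfolding point_count_def B_def
    by (intro ext arg_cong[where f = "\<lambda>S. real (card S)"]) (auto simp: in_cbox_complex_iff)
  have [measurable]: "(\<lambda>z. z) \<in> measurable R borel"
    unfolding R_def by (rule measurable_restrict_space1) simp
  have K: "(\<lambda>(z, w). K_half_plane z w) \<in> borel_measurable (R \<Otimes>\<^sub>M R)"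
    using measurable_compose[OF _ half_plane_kernel_measurable, of "\<lambda>p. (fst p, snd p)" "R \<Otimes>\<^sub>M R"]
    by simp
  define m where "m = L / (4 * pi) * (1 / \<alpha> - 1 / \<beta>)"
  define J where "J = 1 / pi\<^sup>2 * (L * pi / 8 * (\<beta> - \<alpha>)\<^sup>2 / (\<alpha> * \<beta> * (\<alpha> + \<beta>))
                - ln ((\<alpha> + \<beta>)\<^sup>2 / (4 * \<alpha> * \<beta>)))"
  have m: "(\<integral>\<^sup>+z\<in>B. ennreal (Re (K_half_plane z z)) \<partial>lborel) = ennreal m" "0 \<le> m"
  proof -
    show "(\<integral>\<^sup>+z\<in>B. ennreal (Re (K_half_plane z z)) \<partial>lborel) = ennreal m"
      unfolding B_def m_def using assms by (intro half_plane_mean_integral) auto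
    have "1 / \<beta> \<le> 1 / \<alpha>"
      using assms by (intro divide_left_mono) auto
    then show "0 \<le> m"
      unfolding m_def using assms by (intro mult_nonneg_nonneg) auto
  qed
  obtain v where v: "0 \<le> v" "J \<le> v" "v \<le> J + (\<beta> - \<alpha>)\<^sup>2 / (3 * pi\<^sup>2 * L\<^sup>2)"
    "(\<integral>\<^sup>+z\<in>B. (\<integral>\<^sup>+w\<in>B. ennreal ((cmod (K_half_plane z w))\<^sup>2) \<partial>lborel) \<partial>lborel) = ennreal v"
    by (rule half_plane_square_integral_bounds[OF assms(2-4), folded B_def J_def])
  have "variance (point_count Z {\<alpha>..\<beta>} L) = m - v"
    unfolding count
    by (rule variance_card[OF B(1,2,3) order_refl K[unfolded R_def] m v(4,1)])
  moreover have "m - J = L * (1 / \<alpha>) * ((a - 1) * (a + 3) / (8 * pi * a * (a + 1)))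
         + 1 / pi\<^sup>2 * ln ((a + 1)\<^sup>2 / (4 * a))"
  proof -
    have "m - 1 / pi\<^sup>2 * (L * pi / 8 * (\<beta> - \<alpha>)\<^sup>2 / (\<alpha> * \<beta> * (\<alpha> + \<beta>)))
        = L * (1 / \<alpha>) * ((a - 1) * (a + 3) / (8 * pi * a * (a + 1)))"
      using assms unfolding m_def a_def
      by (simp add: divide_simps add_pos_pos) (simp add: algebra_simps power2_eq_square)
    moreover have "(\<alpha> + \<beta>)\<^sup>2 / (4 * \<alpha> * \<beta>) = (a + 1)\<^sup>2 / (4 * a)"
      using assms unfolding a_def
      by (simp add: divide_simps) (simp add: algebra_simps power2_eq_square)
    ultimately show ?thesis unfolding J_def by (simp add: right_diff_distrib)
  qed
  ultimately show ?thesis using v(2,3) by linarith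
qed

theorem corollary6p13:
  fixes M :: "'w measure" and Z :: "'w \<Rightarrow> complex set"
  assumes "determinantal_process M upper_half_plane Z K_half_plane"
  shows "(\<forall>a::real. a > 1 \<longrightarrow>
      (\<lambda>L. prob_space.variance M (point_count Z {1..a} L)
           - (L * ((a - 1) * (a + 3) / (8 * pi * a * (a + 1)))
              + 1 / pi\<^sup>2 * ln ((a + 1)\<^sup>2 / (4 * a))))
        \<in> o[at_top](\<lambda>L::real. 1 :: real)) \<and>
    (\<forall>\<alpha> \<beta> a::real. 0 < \<alpha> \<and> \<alpha> < \<beta> \<and> a = \<beta> / \<alpha> \<longrightarrow>
      (\<lambda>L. prob_space.variance M (point_count Z {\<alpha>..\<beta>} L)
           - (L * (1 / \<alpha>) * ((a - 1) * (a + 3) / (8 * pi * a * (a + 1)))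
              + 1 / pi\<^sup>2 * ln ((a + 1)\<^sup>2 / (4 * a))))
        \<in> o[at_top](\<lambda>L::real. 1 :: real))"
proof -
  have general: "(\<lambda>L. prob_space.variance M (point_count Z {\<alpha>..\<beta>} L)
           - (L * (1 / \<alpha>) * ((\<beta> / \<alpha> - 1) * (\<beta> / \<alpha> + 3) / (8 * pi * (\<beta> / \<alpha>) * (\<beta> / \<alpha> + 1)))
              + 1 / pi\<^sup>2 * ln ((\<beta> / \<alpha> + 1)\<^sup>2 / (4 * (\<beta> / \<alpha>)))))
        \<in> o[at_top](\<lambda>L::real. 1 :: real)" (is "?f \<in> _")
    if "0 < \<alpha>" "\<alpha> < \<beta>" for \<alpha> \<beta> :: real
  proof -
    have "\<forall>\<^sub>F L in at_top. norm (?f L) \<le> (\<beta> - \<alpha>)\<^sup>2 / (3 * pi\<^sup>2) * (1 / L\<^sup>2)"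
      using eventually_ge_at_top[of "2 * \<beta>"]
      by eventually_elim (use half_plane_variance_estimate[OF assms that] in simp)
    moreover have "((\<lambda>L::real. (\<beta> - \<alpha>)\<^sup>2 / (3 * pi\<^sup>2) * (1 / L\<^sup>2)) \<longlongrightarrow> 0) at_top"
      by (intro tendsto_mult_right_zero) real_asymp
    ultimately have "(?f \<longlongrightarrow> 0) at_top"
      by (rule Lim_null_comparison)
    then show ?thesis
      by (intro smalloI_tendsto) auto
  qed
  then show ?thesis
    using general[of 1] by auto
qed

end
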